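(* For every $w\in\{L,R\}^{\mathbb{N}}$, the process $X_t=X^w_t=S_{\eta_t}$, $t\in\mathbb{Z}_{\ge -1}$, is a martingale with respect to its natural filtration. In particular, $E[X_t\mid X_s]=X_s$ (almost surely) for $t\ge s$. Moreover, for every $t\in\mathbb{Z}_{\ge-1}$, $E[X_t]=0$ and $D^2[X_t]=E[\eta_t]$, where $D^2$ denotes the variance.
   Context: Trees: the set $\mathcal{T}$ of (full planar binary) trees is the smallest set containing $\bullet$ and containing $[T_-,T_+]$ whenever $T_-,T_+\in\mathcal{T}$. For finite words $v$ in the letters $L,R$ (with $\varepsilon$ the empty word), trees $T_v$ are defined by $T_\varepsilon=[\bullet,\bullet]$ and, if $T_v=[T_v^-,T_v^+]$, then $T_{vL}=[T_v,T_v^+]$ and $T_{vR}=[T_v^-,T_v]$. Stopping times: let $\Omega$ be the space of sequences $\omega=(\omega_1,\omega_2,\dots)$ with $\omega_i\in\{-1,1\}$, with the product $\sigma$-algebra and the product $\mathbb{P}$ of the measures $\frac12\delta_{-1}+\frac12\delta_1$. Let $\xi_i(\omega)=\omega_i$, $S_0=0$, $S_n=\xi_1+\dots+\xi_n$. For $T\in\mathcal{T}$ define $\tau_T:\Omega\to\mathbb{N}$ recursively: $\tau_\bullet=0$, and for $T=[T_-,T_+]$, $\tau_T(\omega_1,\omega_2,\dots)=1+\tau_{T_-}(\omega_2,\omega_3,\dots)$ if $\omega_1=-1$ and $\tau_T(\omega_1,\omega_2,\dots)=1+\tau_{T_+}(\omega_2,\omega_3,\dots)$ if $\omega_1=+1$.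 Write $S_\tau(\omega)=S_{\tau(\omega)}(\omega)$. For $w=(w_1,w_2,\dots)\in\{L,R\}^{\mathbb{N}}$ put $\eta_{-1}=0$, $\eta_0=\tau_{T_\varepsilon}=1$, and $\eta_t=\tau_{T_{w_1\dots w_t}}$ for $t\ge1$; $X_t=S_{\eta_t}$ for integers $t\ge-1$. *)

theory Defs
  imports "HOL-Probability.Probability"
begin

section \<open>Trees\<close>

datatype pbtree = Bullet | Branch pbtree pbtree

datatype letter = L | R

text \<open>The Bullet equations below only make the function total: no tree of the form
  word_tree v is a single leaf.\<close>

fun extend :: "pbtree \<Rightarrow> letter \<Rightarrow> pbtree" where
  "extend (Branch l r) L = Branch (Branch l r) r"
| "extend (Branch l r) R = Branch l (Branch l r)"
| "extend Bullet _ = Bullet"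

text \<open>The tree T_v; letters act in reading order, so word_tree (v @ [x]) = extend (word_tree v) x.\<close>

definition word_tree :: "letter list \<Rightarrow> pbtree" where
  "word_tree v = foldl extend (Branch Bullet Bullet) v"

lemma word_tree_Nil: "word_tree [] = Branch Bullet Bullet"
  by (simp add: word_tree_def)

lemma word_tree_snoc_L:
  "word_tree v = Branch l r \<Longrightarrow> word_tree (v @ [L]) = Branch (word_tree v) r"
  by (simp add: word_tree_def)

lemma word_tree_snoc_R:
  "word_tree v = Branch l r \<Longrightarrow> word_tree (v @ [R]) = Branch l (word_tree v)"
  by (simp add: word_tree_def)

section \<open>The coin-tossing space and the random walk\<close>

text \<open>The space of this measure is streams {-1, 1}. Streams are indexed from 0, so the
  (i+1)-st toss is \<omega> !! i.\<close>

definition coin_space :: "int stream measure" where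
  "coin_space = stream_space (uniform_count_measure {-1, 1})"

lemma space_coin_space: "space coin_space = streams {-1, 1}"
  by (simp add: coin_space_def space_stream_space space_uniform_count_measure)

lemma prob_space_coin_space: "prob_space coin_space"
  unfolding coin_space_def
  by (intro prob_space.prob_space_stream_space prob_space_uniform_count_measure) auto

definition walk :: "nat \<Rightarrow> int stream \<Rightarrow> int" where
  "walk n \<omega> = (\<Sum>i<n. \<omega> !! i)"

primrec tau :: "pbtree \<Rightarrow> int stream \<Rightarrow> nat" where
  "tau Bullet \<omega> = 0"
| "tau (Branch l r) \<omega> = 1 + (if shd \<omega> = -1 then tau l (stl \<omega>) else tau r (stl \<omega>))"

text \<open>Only times \<open>t \<ge> -1\<close> are meaningful. For \<open>t \<ge> 0\<close>, stake (nat t) w is the word of the first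
  t letters of w; it is empty for t = 0.\<close>

definition eta :: "letter stream \<Rightarrow> int \<Rightarrow> int stream \<Rightarrow> nat" where
  "eta w t \<omega> = (if t < 0 then 0 else tau (word_tree (stake (nat t) w)) \<omega>)"

definition X :: "letter stream \<Rightarrow> int \<Rightarrow> int stream \<Rightarrow> real" where
  "X w t \<omega> = real_of_int (walk (eta w t \<omega>) \<omega>)"

section \<open>Martingales\<close>

text \<open>The \<open>\<sigma>\<close>-algebra generated by the variables Y s with s in I and \<open>s \<le> t\<close>. Like every
  \<open>\<sigma>\<close>-algebra here it is given as a measure of which only space and sets matter.\<close>

definition natural_filtration ::
    "'a measure \<Rightarrow> 't::linorder set \<Rightarrow> ('t \<Rightarrow> 'a \<Rightarrow> real) \<Rightarrow> 't \<Rightarrow> 'a measure" where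
  "natural_filtration M I Y t =
     sigma (space M) {Y s -` A \<inter> space M | s A. s \<in> I \<and> s \<le> t \<and> A \<in> sets borel}"

definition martingale ::
    "'a measure \<Rightarrow> 't::linorder set \<Rightarrow> ('t \<Rightarrow> 'a measure) \<Rightarrow> ('t \<Rightarrow> 'a \<Rightarrow> real) \<Rightarrow> bool" where
  "martingale M I F Y \<longleftrightarrow>
     prob_space M \<and>
     (\<forall>t\<in>I. subalgebra M (F t)) \<and>
     (\<forall>s\<in>I. \<forall>t\<in>I. s \<le> t \<longrightarrow> sets (F s) \<subseteq> sets (F t)) \<and>
     (\<forall>t\<in>I. Y t \<in> borel_measurable (F t)) \<and>
     (\<forall>t\<in>I. integrable M (Y t)) \<and>
     (\<forall>s\<in>I. \<forall>t\<in>I. s \<le> t \<longrightarrow> (AE \<omega> in M. real_cond_exp M (F s) (Y t) \<omega> = Y s \<omega>))"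

end

theory Submission
  imports Defs
begin

text \<open>Passing from \<open>T\<^sub>v\<close> to \<open>T\<^bsub>vL\<^esub>\<close> or \<open>T\<^bsub>vR\<^esub>\<close> grafts trees onto leaves, so the stopping times
  \<open>\<eta>\<^sub>t\<close> increase with t and \<open>X\<^sub>0, \<dots>, X\<^sub>s\<close> are functions of the tosses made up to time \<open>\<eta>\<^sub>s\<close>.
  Optional stopping for two nested trees is an induction on the smaller tree: conditioning
  on the first toss, the contributions of that toss to the two stopped walks cancel.\<close>

section \<open>Trees ordered by refinement\<close>

text \<open>The larger tree arises from the smaller one by grafting a tree onto each leaf, so that
  the larger stopping time dominates the smaller one on every path.\<close>

inductive refined_by :: "pbtree \<Rightarrow> pbtree \<Rightarrow> bool" where
  refined_by_Bullet [simp, intro]: "refined_by Bullet T"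
| refined_by_Branch: "refined_by l l' \<Longrightarrow> refined_by r r' \<Longrightarrow> refined_by (Branch l r) (Branch l' r')"

lemma refined_by_refl [simp, intro]: "refined_by T T"
  by (induction T) (auto intro: refined_by.intros)

lemma refined_by_trans: "refined_by S T \<Longrightarrow> refined_by T U \<Longrightarrow> refined_by S U"
proof (induction arbitrary: U rule: refined_by.induct)
  case (refined_by_Branch l l' r r')
  from refined_by_Branch.prems show ?case
    by cases (auto intro: refined_by.intros refined_by_Branch.IH)
qed simp

text \<open>The condition on the two subtrees is what makes the induction go through: it is preserved by
  both extensions and it implies that an extension refines the tree.\<close>

lemma word_tree_subtrees_refine:
  "\<exists>l r. word_tree v = Branch l r \<and> refined_by l (word_tree v) \<and> refined_by r (word_tree v)"
proof (induction v rule: rev_induct)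
  case (snoc x v)
  then obtain l r where lr: "word_tree v = Branch l r"
    "refined_by l (Branch l r)" "refined_by r (Branch l r)" by auto
  show ?case
  proof (cases x)
    case L
    have "refined_by (Branch l r) (Branch (Branch l r) r)"
      using lr by (auto intro: refined_by_Branch)
    then show ?thesis
      using L lr word_tree_snoc_L[OF lr(1)] by (auto intro: refined_by_trans)
  next
    case R
    have "refined_by (Branch l r) (Branch l (Branch l r))"
      using lr by (auto intro: refined_by_Branch)
    then show ?thesis
      using R lr word_tree_snoc_R[OF lr(1)] by (auto intro: refined_by_trans)
  qed
qed (simp add: word_tree_Nil)

lemma word_tree_refined_by_snoc: "refined_by (word_tree v) (word_tree (v @ [x]))"
proof -
  obtain l r where lr: "word_tree v = Branch l r"
    "refined_by l (word_tree v)" "refined_by r (word_tree v)"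
    using word_tree_subtrees_refine by blast
  then show ?thesis
    by (cases x) (auto simp: word_tree_snoc_L word_tree_snoc_R intro: refined_by_Branch)
qed

lemma word_tree_refined_by_stake: "m \<le> n \<Longrightarrow> refined_by (word_tree (stake m w)) (word_tree (stake n w))"
proof (induction rule: dec_induct)
  case (step n)
  then show ?case
    using word_tree_refined_by_snoc[of "stake n w" "w !! n"]
    \<comment> \<open>Words grow at their end, whereas the default rule for \<open>stake\<close>
      peels letters off the front.\<close>
    by (auto simp: stake_Suc simp del: stake.simps(2) intro: refined_by_trans)
qed simp

text \<open>The leaf has stopping time 0, so time -1 is treated by the same tree arguments as all
  later times.\<close>

definition tree_at :: "letter stream \<Rightarrow> int \<Rightarrow> pbtree" where
  "tree_at w t = (if t < 0 then Bullet else word_tree (stake (nat t) w))"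

lemma tree_at_refined_by: "s \<le> t \<Longrightarrow> refined_by (tree_at w s) (tree_at w t)"
  by (auto simp: tree_at_def intro!: word_tree_refined_by_stake)

lemma eta_eq_tau: "eta w t \<omega> = tau (tree_at w t) \<omega>"
  by (simp add: eta_def tree_at_def)

section \<open>The tosses made before stopping\<close>

text \<open>This list encodes the leaf at which a path leaves the tree. Functions of it are the
  variables known at the stopping time.\<close>

definition tosses :: "pbtree \<Rightarrow> int stream \<Rightarrow> int list" where
  "tosses T \<omega> = stake (tau T \<omega>) \<omega>"

lemma tosses_Bullet [simp]: "tosses Bullet \<omega> = []"
  by (simp add: tosses_def)

lemma tosses_Branch:
  "tosses (Branch l r) \<omega> = shd \<omega> # (if shd \<omega> = -1 then tosses l (stl \<omega>) else tosses r (stl \<omega>))"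
  by (simp add: tosses_def)

lemma tosses_Branch_SCons [simp]:
  "tosses (Branch l r) (x ## \<omega>) = x # (if x = -1 then tosses l \<omega> else tosses r \<omega>)"
  by (simp add: tosses_Branch)

lemma length_tosses [simp]: "length (tosses T \<omega>) = tau T \<omega>"
  by (simp add: tosses_def)

lemma walk_eq_sum_list: "walk n \<omega> = sum_list (stake n \<omega>)"
  by (simp add: walk_def sum_list_sum_nth atLeast0LessThan)

lemma X_eq_sum_tosses: "X w t \<omega> = real_of_int (sum_list (tosses (tree_at w t) \<omega>))"
  by (simp add: X_def walk_eq_sum_list tosses_def eta_eq_tau)

text \<open>The first toss selects the corresponding subtree in both trees, so the path through
  \<open>T\<close> determines its initial segment in \<open>S\<close>.\<close>

lemma tosses_refined_by_cong:
  assumes "refined_by S T" "tosses T \<omega> = tosses T \<omega>'"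
  shows "tosses S \<omega> = tosses S \<omega>'"
  using assms
proof (induction arbitrary: \<omega> \<omega>' rule: refined_by.induct)
  case (refined_by_Branch l l' r r')
  from refined_by_Branch.prems show ?case
    using refined_by_Branch.IH(1)[of "stl \<omega>" "stl \<omega>'"] refined_by_Branch.IH(2)[of "stl \<omega>" "stl \<omega>'"]
    by (cases "shd \<omega> = -1") (auto simp: tosses_Branch)
qed simp

lemma tosses_refined_by_factor:
  assumes "refined_by S T"
  obtains f where "\<And>\<omega>. tosses S \<omega> = f (tosses T \<omega>)"
proof
  fix \<omega>
  \<comment> \<open>The factor evaluates \<open>tosses S\<close> at any stream with the prescribed
    path through \<open>T\<close>; by the congruence the choice is immaterial.\<close>
  have "tosses T (SOME \<omega>'. tosses T \<omega>' = tosses T \<omega>) = tosses T \<omega>"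
    by (rule someI) simp
  then show "tosses S \<omega> = (\<lambda>p. tosses S (SOME \<omega>'. tosses T \<omega>' = p)) (tosses T \<omega>)"
    using tosses_refined_by_cong[OF assms] by metis
qed

text \<open>A tree has finitely many leaves, which makes every real function of
  \<open>tosses T\<close> bounded on the coin space. Over arbitrary integer streams the first entry
  of the list alone could take infinitely many values.\<close>

lemma finite_range_tosses: "finite (tosses T ` streams {-1, 1})"
proof (induction T)
  case (Branch l r)
  have "tosses (Branch l r) ` streams {-1, 1}
    \<subseteq> (#) (-1) ` tosses l ` streams {-1, 1} \<union> (#) 1 ` tosses r ` streams {-1, 1}"
  proof
    fix p assume "p \<in> tosses (Branch l r) ` streams {-1, 1}"
    then obtain \<omega> where "p = tosses (Branch l r) \<omega>" "shd \<omega> \<in> {-1, 1}" "stl \<omega> \<in> streams {-1, 1}"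
      by (auto dest: streams_shd streams_stl)
    then show "p \<in> (#) (-1) ` tosses l ` streams {-1, 1} \<union> (#) 1 ` tosses r ` streams {-1, 1}"
      by (auto simp: tosses_Branch)
  qed
  then show ?case
    using Branch by (auto intro: finite_subset)
qed (auto intro: finite_subset[of _ "{[]}"])

section \<open>Measurability and integrability of functions of the tosses\<close>

lemma measurable_shd_coin_space: "shd \<in> measurable coin_space (count_space UNIV)"
proof (rule measurable_compose[of shd _ "uniform_count_measure {-1, 1}" "\<lambda>x. x"])
  show "shd \<in> measurable coin_space (uniform_count_measure {-1, 1})"
    unfolding coin_space_def by measurable
  show "(\<lambda>x. x) \<in> measurable (uniform_count_measure {-1, 1}) (count_space UNIV)"
    by (auto simp: measurable_def space_uniform_count_measure sets_uniform_count_measure)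
qed

lemma measurable_stl_coin_space: "stl \<in> measurable coin_space coin_space"
  using measurable_stl by (simp add: coin_space_def)

lemma measurable_tosses: "tosses T \<in> measurable coin_space (count_space UNIV)"
proof (induction T)
  case Bullet
  have "tosses Bullet = (\<lambda>_. [])"
    by (rule ext) simp
  then show ?case by simp
next
  case (Branch l r)
  note [measurable] = measurable_shd_coin_space measurable_stl_coin_space Branch
  show ?case
    unfolding tosses_Branch[abs_def] by measurable
qed

lemma integrable_tosses: "integrable coin_space (\<lambda>\<omega>. g (tosses T \<omega>) :: real)"
proof -
  interpret prob_space coin_space by (rule prob_space_coin_space)
  let ?B = "Max ((\<lambda>p. \<bar>g p\<bar>) ` tosses T ` streams {-1, 1})"
  show ?thesis
  proof (rule integrable_const_bound)
    show "AE \<omega> in coin_space. norm (g (tosses T \<omega>)) \<le> ?B"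
      using finite_range_tosses[of T]
      by (intro AE_I2) (auto simp: space_coin_space intro!: Max_ge)
    show "(\<lambda>\<omega>. g (tosses T \<omega>)) \<in> borel_measurable coin_space"
      by (rule measurable_compose[OF measurable_tosses]) simp
  qed
qed

lemma integrable_sum_tosses: "integrable coin_space (\<lambda>\<omega>. real_of_int (sum_list (tosses T \<omega>)))"
  by (rule integrable_tosses)

lemma integrable_X: "integrable coin_space (X w t)"
  by (simp add: X_eq_sum_tosses[abs_def] integrable_sum_tosses)

section \<open>Conditioning on the first toss\<close>

text \<open>The first entry is independent of the tail, which has again the law of the whole stream.
  In this form, the fact lets Fubini's theorem be applied to Bochner integrals.\<close>

lemma (in prob_space) stream_space_eq_distr_SCons:
  "stream_space M = distr (M \<Otimes>\<^sub>M stream_space M) (stream_space M) (\<lambda>(x, \<omega>). x ## \<omega>)"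
proof (rule measure_eqI)
  interpret S: prob_space "stream_space M" by (rule prob_space_stream_space)
  fix A assume A: "A \<in> sets (stream_space M)"
  note [measurable] = A
  have "emeasure (distr (M \<Otimes>\<^sub>M stream_space M) (stream_space M) (\<lambda>(x, \<omega>). x ## \<omega>)) A
    = (\<integral>\<^sup>+p. indicator A ((\<lambda>(x, \<omega>). x ## \<omega>) p) \<partial>(M \<Otimes>\<^sub>M stream_space M))"
    by (subst nn_integral_indicator[symmetric]) (simp_all add: nn_integral_distr del: nn_integral_indicator)
  also have "\<dots> = (\<integral>\<^sup>+x. \<integral>\<^sup>+\<omega>. indicator A (x ## \<omega>) \<partial>stream_space M \<partial>M)"
    by (subst S.nn_integral_fst[symmetric]) simp_all
  also have "\<dots> = emeasure (stream_space M) A"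
    by (subst nn_integral_stream_space[symmetric]) simp_all
  finally show "emeasure (stream_space M) A
    = emeasure (distr (M \<Otimes>\<^sub>M stream_space M) (stream_space M) (\<lambda>(x, \<omega>). x ## \<omega>)) A" ..
qed simp

lemma (in prob_space) integral_stream_space:
  fixes f :: "'a stream \<Rightarrow> 'b::{banach, second_countable_topology}"
  assumes f: "integrable (stream_space M) f"
  shows "(\<integral>\<omega>. f \<omega> \<partial>stream_space M) = (\<integral>x. (\<integral>\<omega>. f (x ## \<omega>) \<partial>stream_space M) \<partial>M)"
proof -
  interpret S: prob_space "stream_space M" by (rule prob_space_stream_space)
  interpret P: pair_sigma_finite M "stream_space M" ..
  let ?c = "\<lambda>(x, \<omega>). x ## \<omega>"
  have [measurable]: "f \<in> borel_measurable (stream_space M)"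
    using f by simp
  have "integrable (M \<Otimes>\<^sub>M stream_space M) (\<lambda>p. f (?c p))"
    by (rule integrable_distr[where M' = "stream_space M"])
      (use f stream_space_eq_distr_SCons in auto)
  then have "(\<integral>p. f (?c p) \<partial>(M \<Otimes>\<^sub>M stream_space M))
    = (\<integral>x. (\<integral>\<omega>. f (x ## \<omega>) \<partial>stream_space M) \<partial>M)"
    by (subst P.integral_fst'[symmetric]) simp_all
  moreover have "(\<integral>\<omega>. f \<omega> \<partial>stream_space M) = (\<integral>p. f (?c p) \<partial>(M \<Otimes>\<^sub>M stream_space M))"
    by (subst stream_space_eq_distr_SCons) (simp add: integral_distr)
  ultimately show ?thesis by simp
qed

lemma integral_coin_space:
  fixes f :: "int stream \<Rightarrow> real"
  assumes "integrable coin_space f"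
  shows "(\<integral>\<omega>. f \<omega> \<partial>coin_space)
    = ((\<integral>\<omega>. f (-1 ## \<omega>) \<partial>coin_space) + (\<integral>\<omega>. f (1 ## \<omega>) \<partial>coin_space)) / 2"
proof -
  interpret prob_space "uniform_count_measure {-1, 1 :: int}"
    by (intro prob_space_uniform_count_measure) auto
  have two_point: "(\<integral>x. h x \<partial>uniform_count_measure {-1, 1 :: int}) = (h (-1) + h 1) / 2"
    for h :: "int \<Rightarrow> real"
    unfolding uniform_count_measure_def
    by (subst lebesgue_integral_point_measure_finite) (simp_all add: field_simps)
  show ?thesis
    using integral_stream_space[of f] assms unfolding coin_space_def two_point .
qed

lemma expectation_tosses_Branch:
  fixes g :: "int list \<Rightarrow> real"
  shows "(\<integral>\<omega>. g (tosses (Branch l r) \<omega>) \<partial>coin_space)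
    = ((\<integral>\<omega>. g (-1 # tosses l \<omega>) \<partial>coin_space) + (\<integral>\<omega>. g (1 # tosses r \<omega>) \<partial>coin_space)) / 2"
  by (subst integral_coin_space) (simp_all add: integrable_tosses)

section \<open>Moments and optional stopping\<close>

text \<open>The first toss contributes -1 and +1 with equal weight, and the remaining walks have
  mean zero by induction.\<close>

lemma expectation_sum_tosses: "(\<integral>\<omega>. real_of_int (sum_list (tosses T \<omega>)) \<partial>coin_space) = 0"
proof (induction T)
  case (Branch l r)
  interpret prob_space coin_space by (rule prob_space_coin_space)
  show ?case
    using Branch expectation_tosses_Branch[of "\<lambda>p. real_of_int (sum_list p)" l r]
    by (simp add: integrable_sum_tosses prob_space)
qed simp

text \<open>Wald's second identity. In the square of the first toss plus the remaining walk, the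
  cross term has mean zero and the squared toss adds 1, matching the 1 in the recursion for
  \<open>tau\<close>.\<close>

lemma expectation_sum_tosses_square:
  "(\<integral>\<omega>. (real_of_int (sum_list (tosses T \<omega>)))\<^sup>2 \<partial>coin_space) = (\<integral>\<omega>. real (tau T \<omega>) \<partial>coin_space)"
proof (induction T)
  case (Branch l r)
  interpret prob_space coin_space by (rule prob_space_coin_space)
  note int = integrable_sum_tosses
    integrable_tosses[of "\<lambda>p. (real_of_int (sum_list p))\<^sup>2"]
    integrable_tosses[of "\<lambda>p. real (length p)", simplified]
  show ?case
    using Branch expectation_tosses_Branch[of "\<lambda>p. (real_of_int (sum_list p))\<^sup>2" l r]
      expectation_tosses_Branch[of "\<lambda>p. real (length p)" l r]
    by (simp add: int prob_space expectation_sum_tosses power2_diff power2_sum)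
qed simp

text \<open>With \<open>g\<close> an indicator this is the defining identity of conditional
  expectation given the path through \<open>S\<close>. The induction needs all \<open>g\<close> at
  once, because the first toss is absorbed into \<open>g\<close>.\<close>

lemma optional_stopping:
  fixes g :: "int list \<Rightarrow> real"
  assumes "refined_by S T"
  shows "(\<integral>\<omega>. g (tosses S \<omega>) * real_of_int (sum_list (tosses T \<omega>)) \<partial>coin_space)
    = (\<integral>\<omega>. g (tosses S \<omega>) * real_of_int (sum_list (tosses S \<omega>)) \<partial>coin_space)"
  using assms
proof (induction arbitrary: g rule: refined_by.induct)
  case (refined_by_Bullet T)
  then show ?case by (simp add: expectation_sum_tosses)
next
  case (refined_by_Branch l l' r r')
  interpret prob_space coin_space by (rule prob_space_coin_space)
  \<comment> \<open>The path through \<open>S\<close> is a function of the path through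
    \<open>T\<close>, so the product depends on the latter alone.\<close>
  have product: "integrable coin_space (\<lambda>\<omega>. h (tosses S \<omega>) * real_of_int (sum_list (tosses T \<omega>)))"
    if ST: "refined_by S T" for h :: "int list \<Rightarrow> real" and S T
  proof -
    obtain f where "\<And>\<omega>. tosses S \<omega> = f (tosses T \<omega>)"
      using tosses_refined_by_factor[OF ST] by blast
    then show ?thesis
      using integrable_tosses[of "\<lambda>p. h (f p) * real_of_int (sum_list p)" T] by simp
  qed
  \<comment> \<open>Used for the subtrees of both the larger and the smaller tree: the terms coming
    from the first toss do not involve \<open>u\<close> and \<open>v\<close>, so they agree on the
    two sides.\<close>
  have split: "(\<integral>\<omega>. g (tosses (Branch l r) \<omega>) * real_of_int (sum_list (tosses (Branch u v) \<omega>)) \<partial>coin_space)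
    = ((\<integral>\<omega>. g (-1 # tosses l \<omega>) * real_of_int (sum_list (tosses u \<omega>)) \<partial>coin_space)
      - (\<integral>\<omega>. g (-1 # tosses l \<omega>) \<partial>coin_space)
      + (\<integral>\<omega>. g (1 # tosses r \<omega>) * real_of_int (sum_list (tosses v \<omega>)) \<partial>coin_space)
      + (\<integral>\<omega>. g (1 # tosses r \<omega>) \<partial>coin_space)) / 2"
    if uv: "refined_by l u" "refined_by r v" for u v
  proof -
    note [simp] = product[OF uv(1), of "\<lambda>p. g (-1 # p)"] product[OF uv(2), of "\<lambda>p. g (1 # p)"]
      integrable_tosses[of "\<lambda>p. g (-1 # p)"] integrable_tosses[of "\<lambda>p. g (1 # p)"]
    show ?thesis
      by (subst integral_coin_space[OF product[OF refined_by.refined_by_Branch[OF uv]]])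
        (simp add: ring_distribs)
  qed
  show ?case
    using refined_by_Branch.IH(1)[of "\<lambda>p. g (-1 # p)"]
      refined_by_Branch.IH(2)[of "\<lambda>p. g (1 # p)"]
    by (simp add: split[OF refined_by_Branch.hyps] split[OF refined_by_refl refined_by_refl])
qed

section \<open>The conditional expectations\<close>

text \<open>The information available at the stopping time. Each of its events is simply a set of
  paths through the tree, which is easier to handle than an event of the natural filtration.\<close>

definition stopped_algebra :: "pbtree \<Rightarrow> int stream measure" where
  "stopped_algebra T = vimage_algebra (space coin_space) (tosses T) (count_space UNIV)"

lemma space_stopped_algebra [simp]: "space (stopped_algebra T) = space coin_space"
  by (simp add: stopped_algebra_def)

lemma sets_stopped_algebra:
  "sets (stopped_algebra T) = {tosses T -` B \<inter> space coin_space | B. True}"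
  by (auto simp: stopped_algebra_def sets_vimage_algebra2)

lemma subalgebra_stopped_algebra: "subalgebra coin_space (stopped_algebra T)"
  using measurable_tosses[of T]
  by (auto simp: subalgebra_def sets_stopped_algebra intro: measurable_sets)

lemma X_measurable_stopped_algebra:
  assumes "r \<le> s"
  shows "X w r \<in> borel_measurable (stopped_algebra (tree_at w s))"
proof -
  obtain f where f: "\<And>\<omega>. tosses (tree_at w r) \<omega> = f (tosses (tree_at w s) \<omega>)"
    using tosses_refined_by_factor[OF tree_at_refined_by[OF assms]] by blast
  have "tosses (tree_at w s) \<in> measurable (stopped_algebra (tree_at w s)) (count_space UNIV)"
    unfolding stopped_algebra_def by (rule measurable_vimage_algebra1) simp
  from measurable_compose[OF this, of "\<lambda>p. real_of_int (sum_list (f p))" borel]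
  show ?thesis
    by (simp add: X_eq_sum_tosses[abs_def] f)
qed

text \<open>Allowing any \<open>F\<close> inside the stopped algebra that makes \<open>X w s\<close>
  measurable covers both the natural filtration and the algebra generated by \<open>X w s\<close>
  alone.\<close>

lemma cond_exp_X:
  assumes "s \<le> t" and F: "subalgebra (stopped_algebra (tree_at w s)) F"
    and meas: "X w s \<in> borel_measurable F"
  shows "AE \<omega> in coin_space. real_cond_exp coin_space F (X w t) \<omega> = X w s \<omega>"
proof -
  interpret prob_space coin_space by (rule prob_space_coin_space)
  have sub: "subalgebra coin_space F"
    using F subalgebra_stopped_algebra[of "tree_at w s"] by (auto simp: subalgebra_def)
  interpret finite_measure_subalgebra coin_space F
    by unfold_locales (rule sub)
  show ?thesis
  proof (rule real_cond_exp_charact)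
    fix A assume "A \<in> sets F"
    then obtain B where A: "A = tosses (tree_at w s) -` B \<inter> space coin_space"
      using F by (auto simp: subalgebra_def sets_stopped_algebra)
    \<comment> \<open>The indicator of \<open>A\<close> becomes a function of the path at time
      \<open>s\<close>, as optional stopping requires; \<open>u\<close> is then taken to be
      \<open>t\<close> and \<open>s\<close>.\<close>
    have "(\<integral>\<omega>\<in>A. X w u \<omega> \<partial>coin_space) = (\<integral>\<omega>. indicator B (tosses (tree_at w s) \<omega>)
        * real_of_int (sum_list (tosses (tree_at w u) \<omega>)) \<partial>coin_space)" for u
      unfolding set_lebesgue_integral_def
      by (rule Bochner_Integration.integral_cong) (auto simp: A X_eq_sum_tosses indicator_def)
    then show "(\<integral>\<omega>\<in>A. X w t \<omega> \<partial>coin_space) = (\<integral>\<omega>\<in>A. X w s \<omega> \<partial>coin_space)"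
      using optional_stopping[OF tree_at_refined_by[OF \<open>s \<le> t\<close>]] by simp
  qed (simp_all add: meas integrable_X)
qed

section \<open>Natural filtrations and the final assembly\<close>

lemma space_natural_filtration [simp]: "space (natural_filtration M I Y t) = space M"
  by (auto simp: natural_filtration_def intro!: space_measure_of)

lemma sets_natural_filtration:
  "sets (natural_filtration M I Y t) =
    sigma_sets (space M) {Y s -` A \<inter> space M | s A. s \<in> I \<and> s \<le> t \<and> A \<in> sets borel}"
  by (auto simp: natural_filtration_def intro!: sets_measure_of)

lemma measurable_natural_filtration:
  "t \<in> I \<Longrightarrow> Y t \<in> borel_measurable (natural_filtration M I Y t)"
  by (rule measurableI) (auto simp: sets_natural_filtration)

lemma natural_filtration_mono:
  "s \<le> t \<Longrightarrow> sets (natural_filtration M I Y s) \<subseteq> sets (natural_filtration M I Y t)"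
  unfolding sets_natural_filtration by (rule sigma_sets_mono') (auto intro: order_trans)

text \<open>Keeping \<open>N\<close> apart from \<open>M\<close> allows \<open>N\<close> to be a
  smaller algebra on the same space, such as the stopped algebra.\<close>

lemma subalgebra_natural_filtration:
  assumes "space N = space M" "\<And>s. s \<in> I \<Longrightarrow> s \<le> t \<Longrightarrow> Y s \<in> borel_measurable N"
  shows "subalgebra N (natural_filtration M I Y t)"
proof -
  have "sigma_sets (space N) {Y s -` A \<inter> space M | s A. s \<in> I \<and> s \<le> t \<and> A \<in> sets borel}
    \<subseteq> sets N"
    using assms by (intro sets.sigma_sets_subset) (auto intro: measurable_sets simp flip: assms(1))
  then show ?thesis
    using assms(1) by (simp add: subalgebra_def sets_natural_filtration)
qed

lemma martingale_X: "martingale coin_space {-1..} (natural_filtration coin_space {-1..} (X w)) (X w)"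
proof -
  \<comment> \<open>All variables up to time \<open>t\<close> are functions of the path at time
    \<open>t\<close>, by refinement of the trees.\<close>
  have stopped: "subalgebra (stopped_algebra (tree_at w t)) (natural_filtration coin_space {-1..} (X w) t)"
    for t
    by (rule subalgebra_natural_filtration) (auto intro: X_measurable_stopped_algebra)
  have "subalgebra coin_space (natural_filtration coin_space {-1..} (X w) t)" for t
    using stopped[of t] subalgebra_stopped_algebra[of "tree_at w t"] by (auto simp: subalgebra_def)
  then show ?thesis
    unfolding martingale_def
    using stopped natural_filtration_mono[of _ _ coin_space "{-1..}" "X w"]
    by (intro conjI ballI impI cond_exp_X)
      (simp_all add: prob_space_coin_space integrable_X measurable_natural_filtration)
qed

theorem theorem16:
  fixes w :: "letter stream"
  shows "martingale coin_space {-1..} (natural_filtration coin_space {-1..} (X w)) (X w)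
    \<and> (\<forall>s t. -1 \<le> s \<and> s \<le> t \<longrightarrow>
        (AE \<omega> in coin_space.
          real_cond_exp coin_space (vimage_algebra (space coin_space) (X w s) borel) (X w t) \<omega>
            = X w s \<omega>))
    \<and> (\<forall>t\<ge>-1.
        integrable coin_space (\<lambda>\<omega>. (X w t \<omega>)\<^sup>2)
        \<and> integrable coin_space (\<lambda>\<omega>. real (eta w t \<omega>))
        \<and> prob_space.expectation coin_space (X w t) = 0
        \<and> prob_space.variance coin_space (X w t)
            = prob_space.expectation coin_space (\<lambda>\<omega>. real (eta w t \<omega>)))"
proof (intro conjI allI impI)
  show "martingale coin_space {-1..} (natural_filtration coin_space {-1..} (X w)) (X w)"
    by (rule martingale_X)
next
  fix s t :: int assume "-1 \<le> s \<and> s \<le> t"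
  \<comment> \<open>Here \<open>F\<close> is the algebra generated by the single variable
    \<open>X w s\<close>.\<close>
  moreover have "subalgebra (stopped_algebra (tree_at w s))
      (vimage_algebra (space coin_space) (X w s) borel)"
    using measurable_sets[OF X_measurable_stopped_algebra[OF order_refl, of w s]]
    by (auto simp: subalgebra_def sets_vimage_algebra2)
  ultimately show "AE \<omega> in coin_space.
      real_cond_exp coin_space (vimage_algebra (space coin_space) (X w s) borel) (X w t) \<omega> = X w s \<omega>"
    by (intro cond_exp_X) (auto intro: measurable_vimage_algebra1)
next
  fix t :: int
  show "integrable coin_space (\<lambda>\<omega>. (X w t \<omega>)\<^sup>2)"
    using integrable_tosses[of "\<lambda>p. (real_of_int (sum_list p))\<^sup>2" "tree_at w t"]
    by (simp add: X_eq_sum_tosses)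
  show "integrable coin_space (\<lambda>\<omega>. real (eta w t \<omega>))"
    using integrable_tosses[of "\<lambda>p. real (length p)" "tree_at w t"] by (simp add: eta_eq_tau)
  show zero: "prob_space.expectation coin_space (X w t) = 0"
    by (simp add: X_eq_sum_tosses[abs_def] expectation_sum_tosses)
  show "prob_space.variance coin_space (X w t)
      = prob_space.expectation coin_space (\<lambda>\<omega>. real (eta w t \<omega>))"
    \<comment> \<open>Since the mean is zero, the variance is the second moment.\<close>
    unfolding zero by (simp add: X_eq_sum_tosses eta_eq_tau expectation_sum_tosses_square)
qed

end
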